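(* Let $G$ be one of Thompson's groups $F$, $T$ or $V$. If $f\in G$ is a torsion element, then $f$ can be represented by a (not necessarily reduced) marked tree pair diagram whose source tree and target tree are the same tree.
   Context: $V$ is the group of right-continuous bijections of $[0,1)$ that are piecewise linear with finitely many breakpoints and discontinuities, all at dyadic rationals, map dyadic rationals to dyadic rationals, and have all slopes (positive) powers of $2$, i.e. $2^k$ with $k\in\mathbb Z$. $T\subset V$ is the subgroup of elements inducing orientation-preserving homeomorphisms of the circle $[0,1]/(0\sim1)$, and $F\subset T$ is the subgroup of elements induced by orientation-preserving homeomorphisms of $[0,1]$. A finite rooted binary tree (every node has $0$ or $2$ children) encodes a subdivision of $[0,1)$ into dyadic subintervals: the root is $[0,1)$ and the children of a node are the left and right halves of its interval; the leaves give the subdivision. A marked tree pair diagram $(T_-,T_+)$ is a pair of such trees with the same number of leaves together with a bijection (the marking) from the leaves of the source tree $T_-$ to the leaves of the target tree $T_+$; it represents the map sending each leaf interval of $T_-$ affinely and increasingly onto the corresponding leaf interval of $T_+$. For elements of $T$ the bijection preserves the cyclic left-to-right order of leaves, and for elements of $F$ it preserves the left-to-right order. *)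

theory Defs
  imports "HOL-Analysis.Analysis" "HOL-Algebra.Bij"
begin

definition dyadic_rationals :: "real set" where
  "dyadic_rationals = {of_int m / 2 ^ k | (m :: int) (k :: nat). True}"

text \<open>Maps of the half-open unit interval to itself are functions on the reals that are
  \<open>undefined\<close> outside it (membership in \<^const>\<open>Bij\<close>), so that equality of functions is equality
  of maps.\<close>

definition thompson_V :: "(real \<Rightarrow> real) set" where
  "thompson_V = {f \<in> Bij {0..<1}.
     (\<forall>x\<in>{0..<1}. continuous (at_right x) f) \<and>
     (\<exists>B. finite B \<and> B \<subseteq> dyadic_rationals \<and>
        (\<forall>a b. 0 \<le> a \<and> a < b \<and> b \<le> 1 \<and> {a<..<b} \<inter> B = {} \<longrightarrow>
           (\<exists>(k :: int) c. \<forall>x\<in>{a<..<b}. f x = 2 powi k * x + c))) \<and>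
     f ` ({0..<1} \<inter> dyadic_rationals) \<subseteq> dyadic_rationals}"

text \<open>The circle obtained from the closed unit interval by gluing 0 and 1 is the complex unit
  circle, via \<open>t \<mapsto> cis (2 * pi * t)\<close>. A homeomorphism of the circle preserves orientation
  if it lifts to an increasing map of the real line.\<close>

definition orientation_preserving_circle_homeo :: "(complex \<Rightarrow> complex) \<Rightarrow> bool" where
  "orientation_preserving_circle_homeo h \<longleftrightarrow>
     (\<exists>h'. homeomorphism (sphere 0 1) (sphere 0 1) h h') \<and>
     (\<exists>L :: real \<Rightarrow> real. continuous_on UNIV L \<and> strict_mono L \<and>
        (\<forall>x. h (cis (2 * pi * x)) = cis (2 * pi * L x)))"

definition thompson_T :: "(real \<Rightarrow> real) set" where
  "thompson_T = {f \<in> thompson_V. \<exists>h. orientation_preserving_circle_homeo h \<and>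
     (\<forall>x\<in>{0..<1}. h (cis (2 * pi * x)) = cis (2 * pi * f x))}"

definition thompson_F :: "(real \<Rightarrow> real) set" where
  "thompson_F = {f \<in> thompson_T. \<exists>g g'. homeomorphism {0..1} {0..1} g g' \<and>
     strict_mono_on {0..1} g \<and> (\<forall>x\<in>{0..<1}. f x = g x)}"

datatype thompson_kind = Kind_F | Kind_T | Kind_V

fun thompson_carrier :: "thompson_kind \<Rightarrow> (real \<Rightarrow> real) set" where
  "thompson_carrier Kind_F = thompson_F"
| "thompson_carrier Kind_T = thompson_T"
| "thompson_carrier Kind_V = thompson_V"

definition thompson_group :: "thompson_kind \<Rightarrow> (real \<Rightarrow> real) monoid" where
  "thompson_group K = (BijGroup {0..<1}) \<lparr>carrier := thompson_carrier K\<rparr>"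

definition torsion_element :: "('a, 'b) monoid_scheme \<Rightarrow> 'a \<Rightarrow> bool" where
  "torsion_element G x \<longleftrightarrow>
     x \<in> carrier G \<and> (\<exists>n :: nat. n > 0 \<and> x [^]\<^bsub>G\<^esub> n = \<one>\<^bsub>G\<^esub>)"

datatype bintree = Leaf | Branch bintree bintree

text \<open>The endpoints of the leaf intervals, from left to right, when the root is \<open>{a..<b}\<close>.\<close>

fun leaf_intervals :: "bintree \<Rightarrow> real \<Rightarrow> real \<Rightarrow> (real \<times> real) list" where
  "leaf_intervals Leaf a b = [(a, b)]"
| "leaf_intervals (Branch l r) a b =
     leaf_intervals l a ((a + b) / 2) @ leaf_intervals r ((a + b) / 2) b"

definition subdivision :: "bintree \<Rightarrow> (real \<times> real) list" where
  "subdivision t = leaf_intervals t 0 1"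

definition num_leaves :: "bintree \<Rightarrow> nat" where
  "num_leaves t = length (subdivision t)"

text \<open>Leaves are numbered from left to right, starting at 0; a marking \<open>\<sigma>\<close> sends leaf \<open>i\<close> of the
  source tree to leaf \<open>\<sigma> i\<close> of the target tree.\<close>

definition marked_tree_pair :: "bintree \<Rightarrow> bintree \<Rightarrow> (nat \<Rightarrow> nat) \<Rightarrow> bool" where
  "marked_tree_pair s t \<sigma> \<longleftrightarrow>
     num_leaves s = num_leaves t \<and> bij_betw \<sigma> {..<num_leaves s} {..<num_leaves t}"

definition cyclically_ordered :: "nat \<Rightarrow> nat \<Rightarrow> nat \<Rightarrow> bool" where
  "cyclically_ordered i j k \<longleftrightarrow> i < j \<and> j < k \<or> j < k \<and> k < i \<or> k < i \<and> i < j"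

fun admissible_marking :: "thompson_kind \<Rightarrow> nat \<Rightarrow> (nat \<Rightarrow> nat) \<Rightarrow> bool" where
  "admissible_marking Kind_F n \<sigma> \<longleftrightarrow> strict_mono_on {..<n} \<sigma>"
| "admissible_marking Kind_T n \<sigma> \<longleftrightarrow>
     (\<forall>i<n. \<forall>j<n. \<forall>k<n. cyclically_ordered i j k \<longrightarrow> cyclically_ordered (\<sigma> i) (\<sigma> j) (\<sigma> k))"
| "admissible_marking Kind_V n \<sigma> \<longleftrightarrow> True"

definition tree_pair_diagram ::
    "thompson_kind \<Rightarrow> bintree \<Rightarrow> bintree \<Rightarrow> (nat \<Rightarrow> nat) \<Rightarrow> bool" where
  "tree_pair_diagram K s t \<sigma> \<longleftrightarrow>
     marked_tree_pair s t \<sigma> \<and> admissible_marking K (num_leaves s) \<sigma>"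

definition represents :: "bintree \<Rightarrow> bintree \<Rightarrow> (nat \<Rightarrow> nat) \<Rightarrow> (real \<Rightarrow> real) \<Rightarrow> bool" where
  "represents s t \<sigma> f \<longleftrightarrow>
     (\<forall>i<num_leaves s. \<forall>a b c d.
        subdivision s ! i = (a, b) \<longrightarrow> subdivision t ! \<sigma> i = (c, d) \<longrightarrow>
        (\<forall>x\<in>{a..<b}. f x = c + (d - c) / (b - a) * (x - a)))"

end

theory Submission
  imports Defs
begin

text \<open>
  A dyadic interval is an interval that occurs in the binary subdivision of \<open>[0, 1)\<close>. Call such an
  interval good for a torsion element \<open>f\<close> if every iterate of \<open>f\<close> maps it affinely onto a dyadic
  interval. The tree sought is the one whose leaves are the maximal good intervals.

  This tree is finite because all sufficiently short dyadic intervals are good. For \<open>f\<close> itself, a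
  short dyadic interval avoids the breakpoints, and once it is short compared with the slope and the
  denominator of the translation part, its image is again dyadic (\<open>thompson_V_dyadic_affine\<close>). The
  property of being affine between dyadic intervals on all short intervals passes to compositions,
  hence to each iterate, and only finitely many iterates are distinct
  (\<open>exists_level_iterates_dyadic_affine\<close>).

  The leaves are permuted by \<open>f\<close>: goodness only depends on the orbit of an interval, so \<open>f\<close> and its
  inverse, which is an iterate of \<open>f\<close>, map good intervals to good intervals. Both preserve inclusion,
  hence maximality (\<open>exists_invariant_tree\<close>).

  The marking records the permutation of the leaves. Its behaviour on leaf numbers is the behaviour of
  \<open>f\<close> on left endpoints, so it inherits the linear order from elements of \<open>F\<close> and the cyclic order from
  elements of \<open>T\<close> (\<open>admissible_marking_if_left_endpoints\<close>).
\<close>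

section \<open>Dyadic intervals\<close>

text \<open>The intervals obtained from \<open>[a, b)\<close> by \<open>r\<close> successive halvings. Halving is what affine maps
  respect and what the children of a tree node are, so that most arguments about these intervals are
  inductions on this relation; endpoints as multiples of \<open>1 / 2 ^ r\<close> only serve to compare with
  breakpoints and values of a concrete map.\<close>

inductive descendant :: "real \<Rightarrow> real \<Rightarrow> nat \<Rightarrow> real \<Rightarrow> real \<Rightarrow> bool" for a b where
  self: "descendant a b 0 a b"
| left: "descendant a b r c d \<Longrightarrow> descendant a b (Suc r) c ((c + d) / 2)"
| right: "descendant a b r c d \<Longrightarrow> descendant a b (Suc r) ((c + d) / 2) d"

abbreviation dyadic_interval :: "nat \<Rightarrow> real \<Rightarrow> real \<Rightarrow> bool" where
  "dyadic_interval \<equiv> descendant 0 1"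

lemma descendant_0_iff: "descendant a b 0 c d \<longleftrightarrow> c = a \<and> d = b"
  by (auto elim: descendant.cases intro: descendant.self)

lemma descendant_trans:
  assumes "descendant c d s u v" "descendant a b r c d"
  shows "descendant a b (r + s) u v"
  using assms by induction (auto intro: descendant.intros)

lemma descendant_split:
  assumes "descendant a b k u v" "k = r + s"
  shows "\<exists>c d. descendant a b r c d \<and> descendant c d s u v"
  using assms
proof (induction arbitrary: s)
  case self
  then show ?case by (auto intro: descendant.self)
next
  case (left k c d)
  show ?case
  proof (cases s)
    case 0
    then show ?thesis using left by (auto simp: descendant_0_iff intro: descendant.left)
  next
    case (Suc s')
    then show ?thesis using left.IH[of s'] left.prems by (auto intro: descendant.left)
  qed
next
  case (right k c d)
  show ?case
  proof (cases s)
    case 0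
    then show ?thesis using right by (auto simp: descendant_0_iff intro: descendant.right)
  next
    case (Suc s')
    then show ?thesis using right.IH[of s'] right.prems by (auto intro: descendant.right)
  qed
qed

text \<open>The relation adds halvings at the bottom; recursion on trees needs the first halving instead.\<close>

lemma descendant_half:
  assumes "descendant a b (Suc r) u v"
  shows "descendant a ((a + b) / 2) r u v \<or> descendant ((a + b) / 2) b r u v"
proof -
  obtain c d where 1: "descendant a b 1 c d" and 2: "descendant c d r u v"
    using descendant_split[OF assms, of 1 r] by auto
  from 1 have "(c = a \<and> d = (a + b) / 2) \<or> (c = (a + b) / 2 \<and> d = b)"
    by (cases rule: descendant.cases) (auto simp: descendant_0_iff)
  with 2 show ?thesis by blast
qed

lemma descendant_length:
  assumes "descendant a b r c d"
  shows "d - c = (b - a) / 2 ^ r"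
  using assms by induction (auto simp: field_simps)

lemma descendant_bounds:
  assumes "descendant a b r c d" "a < b"
  shows "a \<le> c" "c < d" "d \<le> b"
  using assms by (induction) auto

lemma descendant_start:
  assumes "descendant a b r c d"
  shows "\<exists>i::nat. c = a + real i * (b - a) / 2 ^ r"
  using assms
proof induction
  case self
  then show ?case by (auto intro: exI[of _ 0])
next
  case (left r c d)
  then obtain i :: nat where "c = a + real i * (b - a) / 2 ^ r" by blast
  then show ?case by (intro exI[of _ "2 * i"]) (simp add: field_simps)
next
  case (right r c d)
  then obtain i :: nat where i: "c = a + real i * (b - a) / 2 ^ r" by blast
  define h where "h = (b - a) / 2 ^ r"
  have "c = a + real i * h" "d - c = h"
    using i descendant_length[OF right.hyps] by (simp_all add: h_def)
  then have "(c + d) / 2 = a + real (2 * i + 1) * (h / 2)" by (simp add: field_simps)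
  then show ?case by (intro exI[of _ "2 * i + 1"]) (simp add: h_def)
qed

lemma dyadic_interval_iff:
  "dyadic_interval m c d \<longleftrightarrow> (\<exists>j<2 ^ m. c = real j / 2 ^ m \<and> d = real (Suc j) / 2 ^ m)"
proof
  assume *: "dyadic_interval m c d"
  obtain j :: nat where j: "c = real j / 2 ^ m" using descendant_start[OF *] by auto
  have d: "d = real (Suc j) / 2 ^ m"
    using descendant_length[OF *] j by (simp add: field_simps)
  have "d \<le> 1" using descendant_bounds[OF *] by simp
  then have "real (Suc j) \<le> real (2 ^ m)" using d by (simp add: field_simps)
  then have "j < 2 ^ m" unfolding of_nat_le_iff by simp
  with j d show "\<exists>j<2 ^ m. c = real j / 2 ^ m \<and> d = real (Suc j) / 2 ^ m" by blast
next
  have "\<forall>j<2 ^ m. dyadic_interval m (real j / 2 ^ m) (real (Suc j) / 2 ^ m)"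
  proof (induction m)
    case 0
    then show ?case by (auto intro: descendant.self)
  next
    case (Suc m)
    show ?case
    proof (intro allI impI)
      fix j :: nat assume j: "j < 2 ^ Suc m"
      let ?i = "j div 2"
      have "?i < 2 ^ m" using j by auto
      then have *: "dyadic_interval m (real ?i / 2 ^ m) (real (Suc ?i) / 2 ^ m)" using Suc by blast
      show "dyadic_interval (Suc m) (real j / 2 ^ Suc m) (real (Suc j) / 2 ^ Suc m)"
      proof (cases "even j")
        case True
        then have "real j = 2 * real ?i" by (metis dvd_mult_div_cancel of_nat_mult of_nat_numeral)
        then have "(real ?i / 2 ^ m + real (Suc ?i) / 2 ^ m) / 2 = real (Suc j) / 2 ^ Suc m"
          and "real ?i / 2 ^ m = real j / 2 ^ Suc m"
          by (simp_all add: field_simps)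
        then show ?thesis using descendant.left[OF *] by (simp only:)
      next
        case False
        then have "j = 2 * ?i + 1" by presburger
        then have "real j = 2 * real ?i + 1" by (metis of_nat_1 of_nat_add of_nat_mult of_nat_numeral)
        then have "(real ?i / 2 ^ m + real (Suc ?i) / 2 ^ m) / 2 = real j / 2 ^ Suc m"
          and "real (Suc ?i) / 2 ^ m = real (Suc j) / 2 ^ Suc m"
          by (simp_all add: field_simps)
        then show ?thesis using descendant.right[OF *] by (simp only:)
      qed
    qed
  qed
  moreover assume "\<exists>j<2 ^ m. c = real j / 2 ^ m \<and> d = real (Suc j) / 2 ^ m"
  ultimately show "dyadic_interval m c d" by blast
qed

lemma finite_dyadic_intervals: "finite {(c, d). dyadic_interval m c d}"
proof -
  have "{(c, d). dyadic_interval m c d}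
      \<subseteq> (\<lambda>j. (real j / 2 ^ m, real (Suc j) / 2 ^ m)) ` {..<2 ^ m}"
    unfolding dyadic_interval_iff by auto
  then show ?thesis by (rule finite_subset) simp
qed

section \<open>Affine maps between intervals\<close>

text \<open>The increasing affine bijection from \<open>[a, b)\<close> to \<open>[c, d)\<close>, written as in the definition of the map
  that a tree pair represents.\<close>

definition affine_onto :: "(real \<Rightarrow> real) \<Rightarrow> real \<Rightarrow> real \<Rightarrow> real \<Rightarrow> real \<Rightarrow> bool" where
  "affine_onto g a b c d \<longleftrightarrow> (\<forall>x\<in>{a..<b}. g x = c + (d - c) / (b - a) * (x - a))"

lemma affine_onto_start: "affine_onto g a b c d \<Longrightarrow> a < b \<Longrightarrow> g a = c"
  unfolding affine_onto_def by (auto dest: bspec[of _ _ a])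

lemma affine_onto_unique:
  assumes "affine_onto g a b c d" "affine_onto g a b c' d'" "a < b"
  shows "c' = c" "d' = d"
proof -
  show "c' = c" using assms affine_onto_start by metis
  have "c + (d - c) / (b - a) * ((a + b) / 2 - a) = c' + (d' - c') / (b - a) * ((a + b) / 2 - a)"
    using assms(1,2)[unfolded affine_onto_def, THEN bspec[of _ _ "(a + b) / 2"]] assms(3) by simp
  then have "(d - c) / (b - a) = (d' - c') / (b - a)"
    using \<open>c' = c\<close> assms(3) by simp
  then show "d' = d" using \<open>c' = c\<close> assms(3) by simp
qed

lemma affine_onto_mem:
  assumes "affine_onto g a b c d" "c < d" "x \<in> {a..<b}"
  shows "g x \<in> {c..<d}"
proof -
  have "(d - c) / (b - a) * (x - a) < (d - c) / (b - a) * (b - a)"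
    using assms by (intro mult_strict_left_mono) auto
  moreover have "0 \<le> (d - c) / (b - a) * (x - a)" using assms by auto
  ultimately show ?thesis using assms by (auto simp: affine_onto_def)
qed

lemma affine_onto_compose:
  assumes "affine_onto g a b c d" "affine_onto h c d u v" "c < d"
  shows "affine_onto (h \<circ> g) a b u v"
  unfolding affine_onto_def
proof
  fix x assume x: "x \<in> {a..<b}"
  have "h (g x) = u + (v - u) / (d - c) * (g x - c)"
    using assms(2) affine_onto_mem[OF assms(1,3) x] by (auto simp: affine_onto_def)
  also have "g x - c = (d - c) / (b - a) * (x - a)"
    using assms(1) x by (auto simp: affine_onto_def)
  finally show "(h \<circ> g) x = u + (v - u) / (b - a) * (x - a)" using assms(3) by simp
qed

text \<open>Any \<open>h\<close> is determined on \<open>[c, d)\<close> by \<open>h \<circ> g\<close>, since \<open>g\<close> covers that interval. With \<open>g\<close> and \<open>h\<close> powers of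
  one map, this moves affinity along an orbit, and with \<open>h \<circ> g\<close> the identity it shows that the
  inverse of \<open>g\<close> is affine.\<close>

lemma affine_onto_cancel:
  assumes "affine_onto g a b c d" "affine_onto (h \<circ> g) a b u v" "a < b"
  shows "affine_onto h c d u v"
  unfolding affine_onto_def
proof
  fix y assume y: "y \<in> {c..<d}"
  define x where "x = a + (b - a) / (d - c) * (y - c)"
  have "(b - a) / (d - c) * (y - c) < (b - a) / (d - c) * (d - c)"
    using y assms(3) by (intro mult_strict_left_mono) auto
  moreover have "0 \<le> (b - a) / (d - c) * (y - c)" using y assms(3) by auto
  ultimately have x: "x \<in> {a..<b}" using y by (auto simp: x_def)
  have "g x = y" using x y assms(1,3) by (auto simp: affine_onto_def x_def)
  moreover have "h (g x) = u + (v - u) / (b - a) * (x - a)"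
    using x assms(2) by (auto simp: affine_onto_def)
  ultimately show "h y = u + (v - u) / (d - c) * (y - c)"
    using assms(3) by (simp add: x_def)
qed

lemma affine_onto_halves:
  assumes "affine_onto g a b c d" "a < b"
  shows "affine_onto g a ((a + b) / 2) c ((c + d) / 2)"
    and "affine_onto g ((a + b) / 2) b ((c + d) / 2) d"
proof -
  have "((c + d) / 2 - c) / ((a + b) / 2 - a) = (d - c) / (b - a)"
    and "(d - (c + d) / 2) / (b - (a + b) / 2) = (d - c) / (b - a)"
    using assms(2) by (simp_all add: divide_simps) (simp_all add: algebra_simps)
  moreover have "c + (d - c) / (b - a) * (x - a)
      = (c + d) / 2 + (d - c) / (b - a) * (x - (a + b) / 2)" for x
    using assms(2) by (simp add: divide_simps) (simp add: algebra_simps)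
  ultimately show "affine_onto g a ((a + b) / 2) c ((c + d) / 2)"
    and "affine_onto g ((a + b) / 2) b ((c + d) / 2) d"
    using assms by (simp_all add: affine_onto_def)
qed

text \<open>Midpoints go to midpoints, so an affine map between dyadic intervals carries the whole binary
  subdivision of the first to that of the second, level by level.\<close>

lemma affine_onto_descendant:
  assumes "descendant a b r u v" "affine_onto g a b c d" "a < b"
  shows "\<exists>u' v'. descendant c d r u' v' \<and> affine_onto g u v u' v'"
  using assms
proof induction
  case self
  then show ?case by (auto intro: descendant.self)
next
  case (left r u v)
  then obtain u' v' where "descendant c d r u' v'" "affine_onto g u v u' v'" by blast
  then show ?case
    using affine_onto_halves(1) descendant_bounds[OF left.hyps \<open>a < b\<close>]
    by (blast intro: descendant.left)
next
  case (right r u v)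
  then obtain u' v' where "descendant c d r u' v'" "affine_onto g u v u' v'" by blast
  then show ?case
    using affine_onto_halves(2) descendant_bounds[OF right.hyps \<open>a < b\<close>]
    by (blast intro: descendant.right)
qed

section \<open>Subdividing until a map is affine between dyadic intervals\<close>

definition dyadic_affine :: "(real \<Rightarrow> real) \<Rightarrow> real \<Rightarrow> real \<Rightarrow> bool" where
  "dyadic_affine g a b \<longleftrightarrow> (\<exists>l c d. dyadic_interval l c d \<and> affine_onto g a b c d)"

lemma dyadic_affine_descendant:
  assumes "dyadic_affine g a b" "descendant a b r u v" "a < b"
  shows "dyadic_affine g u v"
  using affine_onto_descendant[OF assms(2)] descendant_trans assms(1,3)
  unfolding dyadic_affine_def by blast

lemma dyadic_affine_level_mono:
  assumes N: "\<And>a b. dyadic_interval N a b \<Longrightarrow> dyadic_affine g a b"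
    and "N \<le> M" "dyadic_interval M a b"
  shows "dyadic_affine g a b"
proof -
  obtain u v where "dyadic_interval N u v" "descendant u v (M - N) a b"
    using descendant_split[OF assms(3), of N "M - N"] assms(2) by auto
  then show ?thesis
    using N dyadic_affine_descendant descendant_bounds(2) zero_less_one by metis
qed

text \<open>An interval whose length and starting point fit the grid of mesh \<open>1 / 2 ^ l\<close> cannot cross the point
  1 if it starts before it.\<close>

lemma dyadic_interval_if_dyadic_start:
  fixes p :: int
  assumes "u = of_int p / 2 ^ l" "u \<in> {0..<1}"
  shows "dyadic_interval l u (u + 1 / 2 ^ l)"
proof -
  have "0 \<le> u * 2 ^ l" using assms(2) by simp
  then have "0 \<le> (of_int p :: real)" using assms(1) by simp
  then have "0 \<le> p" by simp
  then have p: "real (nat p) = of_int p" by simp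
  have "real_of_int p < 2 ^ l" using assms by (simp add: divide_less_eq)
  then have "real (nat p) < real (2 ^ l)" using p by simp
  then have "nat p < 2 ^ l" unfolding of_nat_less_iff .
  then show ?thesis
    unfolding dyadic_interval_iff
    by (intro exI[of _ "nat p"]) (simp add: assms(1) p add_divide_distrib)
qed

text \<open>The image of a descendant \<open>[u, v)\<close> at depth \<open>r\<close> has length \<open>1 / 2 ^ l\<close> with \<open>l = m + r - k\<close>, and starts at
  \<open>f a\<close> plus a multiple of that length. As soon as \<open>l\<close> is at least the exponent \<open>q\<close> of the denominator of
  \<open>f a\<close>, the starting point is on the grid of mesh \<open>1 / 2 ^ l\<close>.\<close>

lemma dyadic_affine_eventually:
  fixes k :: int
  assumes I: "dyadic_interval m a b"
    and f: "\<And>x. x \<in> {a..<b} \<Longrightarrow> f x = f a + 2 powi k * (x - a)"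
    and into: "\<And>x. x \<in> {a..<b} \<Longrightarrow> f x \<in> {0..<1}"
    and fa: "f a \<in> dyadic_rationals"
  shows "\<forall>\<^sub>F r in sequentially. \<forall>u v. descendant a b r u v \<longrightarrow> dyadic_affine f u v"
proof -
  obtain p q where pq: "f a = of_int p / 2 ^ q" using fa by (auto simp: dyadic_rationals_def)
  have ab: "a < b" using descendant_bounds[OF I] by simp
  \<comment> \<open>This bound on \<open>r\<close> makes \<open>m + r - k\<close> nonnegative and at least \<open>q\<close>.\<close>
  have "dyadic_affine f u v" if r: "r \<ge> nat (k + int q)" and uv: "descendant a b r u v" for r u v
  proof -
    define l where "l = nat (int m + int r - k)"
    have l: "int l = int m + int r - k" "q \<le> l" using r by (auto simp: l_def)
    have "(2::real) powi k = 2 powi (int (m + r) - int l)" using l by simp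
    then have slope: "(2::real) powi k = 2 ^ (m + r) / 2 ^ l"
      by (simp add: power_int_diff del: of_nat_add)
    have len: "b - a = 1 / 2 ^ m" using descendant_length[OF I] by simp
    have len': "v - u = 1 / 2 ^ (m + r)"
      using descendant_length[OF uv] by (simp add: len power_add)
    obtain i :: nat where i: "u = a + real i * (b - a) / 2 ^ r"
      using descendant_start[OF uv] by blast
    note bds = descendant_bounds[OF uv ab]
    have "f u = f a + 2 powi k * (real i * (b - a) / 2 ^ r)"
      using f[of u] bds i by simp
    also have "\<dots> = of_int p / 2 ^ q + real i / 2 ^ l"
      by (simp add: pq slope len power_add)
    also have "\<dots> = of_int (p * 2 ^ (l - q) + int i) / 2 ^ l"
      using l(2) by (simp add: field_simps flip: power_add)
    finally have fu: "f u = of_int (p * 2 ^ (l - q) + int i) / 2 ^ l" .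
    have "dyadic_interval l (f u) (f u + 1 / 2 ^ l)"
      by (rule dyadic_interval_if_dyadic_start[OF fu]) (use into[of u] bds in auto)
    moreover have "affine_onto f u v (f u) (f u + 1 / 2 ^ l)"
      unfolding affine_onto_def
    proof
      fix x assume "x \<in> {u..<v}"
      then have "f x = f a + 2 powi k * (x - a)" "f u = f a + 2 powi k * (u - a)"
        using bds by (auto intro!: f)
      then have "f x = f u + 2 powi k * (x - u)" by (simp add: algebra_simps)
      then show "f x = f u + (f u + 1 / 2 ^ l - f u) / (v - u) * (x - u)"
        unfolding slope len' by simp
    qed
    ultimately show ?thesis unfolding dyadic_affine_def by blast
  qed
  then show ?thesis unfolding eventually_sequentially by blast
qed

lemma dyadic_rationals_common_denominator:
  assumes "finite B" "B \<subseteq> dyadic_rationals"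
  shows "\<exists>m. \<forall>x\<in>B. \<exists>p::int. x = of_int p / 2 ^ m"
  using assms
proof induction
  case empty
  then show ?case by simp
next
  case (insert y B)
  then obtain m where m: "\<forall>x\<in>B. \<exists>p::int. x = of_int p / 2 ^ m" by auto
  obtain q k where y: "y = of_int q / 2 ^ k" using insert.prems by (auto simp: dyadic_rationals_def)
  have *: "\<exists>p'::int. of_int p / 2 ^ s = (of_int p' / 2 ^ (s + s') :: real)" for p :: int and s s'
    by (rule exI[of _ "p * 2 ^ s'"]) (simp add: power_add)
  have "\<exists>p::int. y = of_int p / 2 ^ (m + k)" using *[of q k m] y by (simp add: add.commute)
  moreover have "\<forall>x\<in>B. \<exists>p::int. x = of_int p / 2 ^ (m + k)" using m * by metis
  ultimately show ?case by blast
qed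

text \<open>The level \<open>m\<close> is chosen so that all breakpoints lie on the grid of mesh \<open>1 / 2 ^ m\<close>; each of the finitely
  many intervals of level \<open>m\<close> then needs some further subdivision, and the deepest one serves all.\<close>

lemma thompson_V_dyadic_affine:
  assumes "f \<in> thompson_V"
  shows "\<exists>N. \<forall>a b. dyadic_interval N a b \<longrightarrow> dyadic_affine f a b"
proof -
  have cont: "\<And>x. x \<in> {0..<1} \<Longrightarrow> continuous (at_right x) f"
    and dy: "f ` ({0..<1} \<inter> dyadic_rationals) \<subseteq> dyadic_rationals"
    and into: "\<And>x. x \<in> {0..<1} \<Longrightarrow> f x \<in> {0..<1}"
    using assms by (auto simp: thompson_V_def Bij_def bij_betw_def)
  obtain B where B: "finite B" "B \<subseteq> dyadic_rationals"
    and aff: "\<And>a b. 0 \<le> a \<Longrightarrow> a < b \<Longrightarrow> b \<le> 1 \<Longrightarrow> {a<..<b} \<inter> B = {} \<Longrightarrow>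
           \<exists>(k :: int) c. \<forall>x\<in>{a<..<b}. f x = 2 powi k * x + c"
  proof -
    have "\<exists>B. finite B \<and> B \<subseteq> dyadic_rationals \<and>
        (\<forall>a b. 0 \<le> a \<and> a < b \<and> b \<le> 1 \<and> {a<..<b} \<inter> B = {} \<longrightarrow>
           (\<exists>(k :: int) c. \<forall>x\<in>{a<..<b}. f x = 2 powi k * x + c))"
      using assms by (simp add: thompson_V_def)
    then show thesis by (elim exE conjE) (rule that, assumption+, blast)
  qed
  obtain m where m: "\<And>x. x \<in> B \<Longrightarrow> \<exists>p::int. x = of_int p / 2 ^ m"
    using dyadic_rationals_common_denominator[OF B] by blast
  have ev: "\<forall>\<^sub>F r in sequentially. \<forall>u v. descendant a b r u v \<longrightarrow> dyadic_affine f u v"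
    if I: "dyadic_interval m a b" for a b
  proof -
    obtain j where j: "a = real j / 2 ^ m" "b = real (Suc j) / 2 ^ m"
      using I unfolding dyadic_interval_iff by blast
    have ab: "0 \<le> a" "a < b" "b \<le> 1" using descendant_bounds[OF I] by auto
    have "{a<..<b} \<inter> B = {}"
    proof (rule ccontr)
      assume "{a<..<b} \<inter> B \<noteq> {}"
      then obtain x where "a < x" "x < b" "x \<in> B" by auto
      then obtain p :: int where "a < of_int p / 2 ^ m" "of_int p / 2 ^ m < b" using m by metis
      then have "of_int (int j) < (of_int p :: real)" "(of_int p :: real) < of_int (int j + 1)"
        unfolding j by (simp_all add: divide_less_cancel)
      then show False unfolding of_int_less_iff by simp
    qed
    then obtain k :: int and c where kc: "\<And>x. x \<in> {a<..<b} \<Longrightarrow> f x = 2 powi k * x + c"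
      using aff ab by blast
    \<comment> \<open>The affine formula holds on the open interval only; right continuity extends it to \<open>a\<close>.\<close>
    have "((\<lambda>x. 2 powi k * x + c) \<longlongrightarrow> 2 powi k * a + c) (at_right a)"
      by (intro tendsto_intros)
    moreover have "\<forall>\<^sub>F x in at_right a. 2 powi k * x + c = f x"
      using ab kc by (auto simp: eventually_at_right_field)
    ultimately have "(f \<longlongrightarrow> 2 powi k * a + c) (at_right a)"
      by (rule Lim_transform_eventually)
    moreover have "(f \<longlongrightarrow> f a) (at_right a)"
      using cont[of a] ab by (simp add: continuous_within)
    ultimately have fa: "f a = 2 powi k * a + c"
      using tendsto_unique trivial_limit_at_right_real by blast
    show ?thesis
    proof (rule dyadic_affine_eventually[OF I])
      fix x assume "x \<in> {a..<b}"
      then show "f x = f a + 2 powi k * (x - a)"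
        using fa kc[of x] by (cases "x = a") (auto simp: algebra_simps)
    next
      fix x assume "x \<in> {a..<b}"
      then show "f x \<in> {0..<1}" using ab into by simp
    next
      have "a = of_int (int j) / 2 ^ m" using j by simp
      then have "a \<in> dyadic_rationals" unfolding dyadic_rationals_def by blast
      then show "f a \<in> dyadic_rationals" using dy ab by auto
    qed
  qed
  have "\<forall>\<^sub>F r in sequentially. \<forall>I\<in>{(a, b). dyadic_interval m a b}.
          \<forall>u v. descendant (fst I) (snd I) r u v \<longrightarrow> dyadic_affine f u v"
    by (rule eventually_ball_finite[OF finite_dyadic_intervals]) (use ev in auto)
  then obtain r where r: "\<And>a b u v. dyadic_interval m a b \<Longrightarrow> descendant a b r u v \<Longrightarrow> dyadic_affine f u v"
    using eventually_happens trivial_limit_sequentially by fastforce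
  have "dyadic_affine f u v" if "dyadic_interval (m + r) u v" for u v
    using descendant_split[OF that refl] r by blast
  then show ?thesis by blast
qed

text \<open>The map \<open>f\<close> may lengthen intervals, but an interval \<open>M\<close> levels below one of level \<open>N\<close> has an image \<open>M\<close>
  levels below some dyadic interval, hence of level at least \<open>M\<close>.\<close>

lemma dyadic_affine_compose:
  assumes f: "\<And>a b. dyadic_interval N a b \<Longrightarrow> dyadic_affine f a b"
    and g: "\<And>a b. dyadic_interval M a b \<Longrightarrow> dyadic_affine g a b"
    and ab: "dyadic_interval (N + M) a b"
  shows "dyadic_affine (g \<circ> f) a b"
proof -
  obtain u v where uv: "dyadic_interval N u v" "descendant u v M a b"
    using descendant_split[OF ab refl] by blast
  obtain l c d where cd: "dyadic_interval l c d" "affine_onto f u v c d"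
    using f[OF uv(1)] unfolding dyadic_affine_def by blast
  obtain c' d' where c'd': "descendant c d M c' d'" "affine_onto f a b c' d'"
    using affine_onto_descendant[OF uv(2) cd(2)] descendant_bounds[OF uv(1)] by auto
  have D: "dyadic_interval (l + M) c' d'" using descendant_trans[OF c'd'(1) cd(1)] .
  have "dyadic_affine g c' d'" by (rule dyadic_affine_level_mono[OF g _ D]) auto
  then obtain k s t where "dyadic_interval k s t" "affine_onto g c' d' s t"
    unfolding dyadic_affine_def by blast
  moreover have "c' < d'" using descendant_bounds[OF D] by simp
  ultimately show ?thesis
    using affine_onto_compose[OF c'd'(2)] unfolding dyadic_affine_def by blast
qed

lemma dyadic_affine_funpow:
  assumes "\<And>a b. dyadic_interval N a b \<Longrightarrow> dyadic_affine f a b"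
  shows "dyadic_interval (i * N) a b \<Longrightarrow> dyadic_affine (f ^^ i) a b"
proof (induction i arbitrary: a b)
  case 0
  then have "affine_onto (f ^^ 0) a b a b"
    using descendant_bounds[OF 0] by (simp add: affine_onto_def)
  then show ?case using 0 unfolding dyadic_affine_def by blast
next
  case (Suc i)
  have "dyadic_affine (f ^^ i \<circ> f) a b"
    using Suc.prems by (intro dyadic_affine_compose[OF assms Suc.IH]) auto
  then show ?case by (simp only: funpow_Suc_right)
qed

section \<open>Maximal good intervals and the invariant tree\<close>

lemma leaf_intervals_descendant:
  "(c, d) \<in> set (leaf_intervals t a b) \<Longrightarrow> \<exists>r. descendant a b r c d"
proof (induction t arbitrary: a b)
  case Leaf
  then show ?case by (auto intro: descendant.self)
next
  case (Branch l r)
  have "descendant a b 1 a ((a + b) / 2)" "descendant a b 1 ((a + b) / 2) b"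
    using descendant.left[OF descendant.self] descendant.right[OF descendant.self] by auto
  then show ?case using Branch descendant_trans by fastforce
qed

lemma leaf_intervals_sorted:
  "a < b \<Longrightarrow> sorted_wrt (\<lambda>I J. snd I \<le> fst J) (leaf_intervals t a b)"
proof (induction t arbitrary: a b)
  case Leaf
  then show ?case by simp
next
  case (Branch l r)
  have "snd I \<le> fst J" if IJ: "I \<in> set (leaf_intervals l a ((a + b) / 2))"
    "J \<in> set (leaf_intervals r ((a + b) / 2) b)" for I J
  proof -
    obtain p where p: "descendant a ((a + b) / 2) p (fst I) (snd I)"
      using leaf_intervals_descendant[of "fst I" "snd I" l a "(a + b) / 2"] IJ(1) by auto
    obtain q where q: "descendant ((a + b) / 2) b q (fst J) (snd J)"
      using leaf_intervals_descendant[of "fst J" "snd J" r "(a + b) / 2" b] IJ(2) by auto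
    show ?thesis
      using descendant_bounds(3)[OF p] descendant_bounds(1)[OF q] Branch.prems by simp
  qed
  then show ?case using Branch by (auto simp: sorted_wrt_append)
qed

text \<open>Subdivide until \<open>P\<close> holds and stop as early as possible: the leaves are then the maximal intervals
  with \<open>P\<close>, because an interval strictly inside a node without \<open>P\<close> lies in one of its halves. The
  assumption that \<open>P\<close> holds at depth \<open>r\<close> makes the process end.\<close>

lemma exists_tree_of_maximal_intervals:
  assumes "\<And>c d. descendant a b r c d \<Longrightarrow> P c d"
  shows "\<exists>t. (\<forall>(c, d)\<in>set (leaf_intervals t a b). P c d) \<and>
     (\<forall>s c d. descendant a b s c d \<longrightarrow> P c d \<longrightarrow>
        (\<exists>u v q. (u, v) \<in> set (leaf_intervals t a b) \<and> descendant u v q c d))"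
  using assms
proof (induction r arbitrary: a b)
  case 0
  then have "P a b" by (auto simp: descendant_0_iff)
  then show ?case by (intro exI[of _ Leaf]) auto
next
  case (Suc r)
  let ?m = "(a + b) / 2"
  show ?case
  proof (cases "P a b")
    case True
    then show ?thesis by (intro exI[of _ Leaf]) auto
  next
    case False
    have "descendant a b (Suc r) c d" if "descendant a ?m r c d \<or> descendant ?m b r c d" for c d
      using that descendant_trans[of _ _ r c d a b 1]
        descendant.left[OF descendant.self] descendant.right[OF descendant.self] by auto
    then have P: "P c d" if "descendant a ?m r c d \<or> descendant ?m b r c d" for c d
      using that Suc.prems by blast
    obtain t1 where t1: "\<forall>(c, d)\<in>set (leaf_intervals t1 a ?m). P c d"
      "\<And>s c d. descendant a ?m s c d \<Longrightarrow> P c d \<Longrightarrow>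
        \<exists>u v q. (u, v) \<in> set (leaf_intervals t1 a ?m) \<and> descendant u v q c d"
      using Suc.IH[of a ?m] P by blast
    obtain t2 where t2: "\<forall>(c, d)\<in>set (leaf_intervals t2 ?m b). P c d"
      "\<And>s c d. descendant ?m b s c d \<Longrightarrow> P c d \<Longrightarrow>
        \<exists>u v q. (u, v) \<in> set (leaf_intervals t2 ?m b) \<and> descendant u v q c d"
      using Suc.IH[of ?m b] P by blast
    have "\<exists>u v q. (u, v) \<in> set (leaf_intervals (Branch t1 t2) a b) \<and> descendant u v q c d"
      if cd: "descendant a b s c d" "P c d" for s c d
    proof (cases s)
      case 0
      then show ?thesis using cd False by (auto simp: descendant_0_iff)
    next
      case (Suc s')
      then have "descendant a ?m s' c d \<or> descendant ?m b s' c d"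
        using cd descendant_half by blast
      then show ?thesis using t1(2) t2(2) cd(2) by fastforce
    qed
    then show ?thesis using t1(1) t2(1) by (intro exI[of _ "Branch t1 t2"]) auto
  qed
qed

text \<open>The good intervals. All iterates occur, without a bound by the order of \<open>f\<close>, so that passing from an
  interval to its image under an iterate is a mere shift of the exponent.\<close>

definition iterates_dyadic_affine :: "(real \<Rightarrow> real) \<Rightarrow> real \<Rightarrow> real \<Rightarrow> bool" where
  "iterates_dyadic_affine f a b \<longleftrightarrow> (\<forall>i. dyadic_affine (f ^^ i) a b)"

lemma iterates_dyadic_affine_image:
  assumes "iterates_dyadic_affine f a b" "affine_onto (f ^^ j) a b c d" "a < b"
  shows "iterates_dyadic_affine f c d"
  unfolding iterates_dyadic_affine_def
proof
  fix i
  have "dyadic_affine (f ^^ (i + j)) a b" using assms(1) unfolding iterates_dyadic_affine_def by blast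
  then obtain l u v where "dyadic_interval l u v" "affine_onto (f ^^ (i + j)) a b u v"
    unfolding dyadic_affine_def by blast
  then have "affine_onto (f ^^ i) c d u v"
    by (intro affine_onto_cancel[OF assms(2) _ assms(3)]) (simp add: funpow_add)
  with \<open>dyadic_interval l u v\<close> show "dyadic_affine (f ^^ i) c d"
    unfolding dyadic_affine_def by blast
qed

text \<open>The level \<open>n * N\<close> suffices for the iterates with exponent below \<open>n\<close>, and every other iterate agrees on
  \<open>[0, 1)\<close> with one of these.\<close>

lemma exists_level_iterates_dyadic_affine:
  assumes "f \<in> thompson_V" "n > 0" and per: "\<And>x. x \<in> {0..<1} \<Longrightarrow> (f ^^ n) x = x"
  shows "\<exists>N. \<forall>a b. dyadic_interval N a b \<longrightarrow> iterates_dyadic_affine f a b"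
proof -
  obtain N where N: "\<And>a b. dyadic_interval N a b \<Longrightarrow> dyadic_affine f a b"
    using thompson_V_dyadic_affine[OF assms(1)] by blast
  have "iterates_dyadic_affine f a b" if ab: "dyadic_interval (n * N) a b" for a b
    unfolding iterates_dyadic_affine_def
  proof
    fix i
    have level: "dyadic_affine (f ^^ (i mod n)) c d" if "dyadic_interval (i mod n * N) c d" for c d
      using N that by (rule dyadic_affine_funpow)
    have "i mod n * N \<le> n * N" using assms(2) by (simp add: less_imp_le)
    with level have "dyadic_affine (f ^^ (i mod n)) a b"
      using ab by (rule dyadic_affine_level_mono)
    moreover have "(f ^^ (i mod n)) x = (f ^^ i) x" if "x \<in> {a..<b}" for x
      using that descendant_bounds[OF ab] per[of x] by (intro funpow_mod_eq) auto
    ultimately show "dyadic_affine (f ^^ i) a b"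
      unfolding dyadic_affine_def affine_onto_def by auto
  qed
  then show ?thesis by blast
qed

text \<open>Leaves are pairwise disjoint, so a leaf inside another one is the same, and then its length forces
  the depth to be 0.\<close>

lemma descendant_leaf_is_leaf:
  assumes "(a, b) \<in> set (leaf_intervals t x y)" "(u, v) \<in> set (leaf_intervals t x y)"
    and "descendant u v q a b" "x < y"
  shows "q = 0"
proof -
  let ?L = "leaf_intervals t x y"
  obtain i j where ij: "i < length ?L" "?L ! i = (a, b)" "j < length ?L" "?L ! j = (u, v)"
    using assms(1,2) by (auto simp: in_set_conv_nth)
  have uv: "u < v" using leaf_intervals_descendant[OF assms(2)] descendant_bounds assms(4) by blast
  note bds = descendant_bounds[OF assms(3) uv]
  have "snd (?L ! k) \<le> fst (?L ! l)" if "k < l" "l < length ?L" for k l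
    using sorted_wrt_nth_less[OF leaf_intervals_sorted[OF assms(4)]] that by blast
  from this[of i j] this[of j i] ij bds have "i = j" by (cases i j rule: linorder_cases) auto
  then have "b - a = v - u" using ij by simp
  then have "v - u = (v - u) / 2 ^ q" using descendant_length[OF assms(3)] by simp
  then have "(2::real) ^ q = 1" using uv by (simp add: eq_divide_eq)
  then show ?thesis by (metis less_numeral_extra(4) neq0_conv one_less_numeral_iff one_less_power semiring_norm(76))
qed

text \<open>Let \<open>f\<close> map the leaf \<open>[a, b)\<close> onto \<open>[c, d)\<close>, which is good and hence inside a leaf \<open>[u, v)\<close>. The inverse
  of \<open>f\<close>, as the iterate with exponent \<open>n - 1\<close>, maps \<open>[u, v)\<close> onto a good interval \<open>[a', b')\<close> that contains
  \<open>[a, b)\<close> at the same depth \<open>q\<close> as \<open>[c, d)\<close> has in \<open>[u, v)\<close>. That interval is inside a leaf too, which must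
  be \<open>[a, b)\<close> itself. So \<open>q = 0\<close> and \<open>[c, d)\<close> is the leaf \<open>[u, v)\<close>.\<close>

lemma exists_invariant_tree:
  assumes "f \<in> thompson_V" "n > 0" and per: "\<And>x. x \<in> {0..<1} \<Longrightarrow> (f ^^ n) x = x"
  shows "\<exists>t. \<forall>(a, b)\<in>set (subdivision t). \<exists>(c, d)\<in>set (subdivision t). affine_onto f a b c d"
proof -
  obtain N where N: "\<And>a b. dyadic_interval N a b \<Longrightarrow> iterates_dyadic_affine f a b"
    using exists_level_iterates_dyadic_affine[OF assms] by blast
  obtain t where leaf: "\<And>a b. (a, b) \<in> set (subdivision t) \<Longrightarrow> iterates_dyadic_affine f a b"
    and maximal: "\<And>s a b. dyadic_interval s a b \<Longrightarrow> iterates_dyadic_affine f a b \<Longrightarrow>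
        \<exists>u v q. (u, v) \<in> set (subdivision t) \<and> descendant u v q a b"
    using exists_tree_of_maximal_intervals[of 0 1 N "iterates_dyadic_affine f", OF N]
    unfolding subdivision_def by blast
  have std: "\<exists>r. dyadic_interval r a b" if "(a, b) \<in> set (subdivision t)" for a b
    using leaf_intervals_descendant that unfolding subdivision_def by blast
  have "\<exists>c d. (c, d) \<in> set (subdivision t) \<and> affine_onto f a b c d"
    if ab: "(a, b) \<in> set (subdivision t)" for a b
  proof -
    have lt: "0 \<le> a" "a < b" "b \<le> 1" using std[OF ab] descendant_bounds by (force)+
    have "dyadic_affine (f ^^ 1) a b" using leaf[OF ab] unfolding iterates_dyadic_affine_def by blast
    then obtain l c d where cd: "dyadic_interval l c d" "affine_onto (f ^^ 1) a b c d"
      unfolding dyadic_affine_def by blast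
    obtain u v q where uv: "(u, v) \<in> set (subdivision t)" "descendant u v q c d"
      using maximal[OF cd(1) iterates_dyadic_affine_image[OF leaf[OF ab] cd(2) lt(2)]] by blast
    have "u < v" using std[OF uv(1)] descendant_bounds by force
    have "dyadic_affine (f ^^ (n - 1)) u v" using leaf[OF uv(1)] unfolding iterates_dyadic_affine_def by blast
    then obtain l' a' b' where a'b': "dyadic_interval l' a' b'" "affine_onto (f ^^ (n - 1)) u v a' b'"
      unfolding dyadic_affine_def by blast
    have inverse_aff: "affine_onto (f ^^ (n - 1)) c d a b"
    proof (rule affine_onto_cancel[OF cd(2) _ lt(2)])
      have "(f ^^ (n - 1)) \<circ> (f ^^ 1) = f ^^ n" using assms(2) by (metis funpow_add Suc_leI le_add_diff_inverse2 One_nat_def)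
      then show "affine_onto ((f ^^ (n - 1)) \<circ> (f ^^ 1)) a b a b"
        using per lt by (auto simp: affine_onto_def)
    qed
    have "descendant a' b' q a b"
      using affine_onto_descendant[OF uv(2) a'b'(2) \<open>u < v\<close>] affine_onto_unique[OF inverse_aff]
        descendant_bounds[OF cd(1)] by auto
    moreover obtain u' v' p where u'v': "(u', v') \<in> set (subdivision t)" "descendant u' v' p a' b'"
      using maximal[OF a'b'(1) iterates_dyadic_affine_image[OF leaf[OF uv(1)] a'b'(2) \<open>u < v\<close>]] by blast
    ultimately have "descendant u' v' (p + q) a b" using descendant_trans by blast
    then have "p + q = 0"
      using descendant_leaf_is_leaf[of a b t 0 1 u' v' "p + q"] ab u'v'(1)
      unfolding subdivision_def by simp
    then have "q = 0" by simp
    then show ?thesis using uv cd(2) by (auto simp: descendant_0_iff)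
  qed
  then show ?thesis by fast
qed

section \<open>Order properties of elements of F and T\<close>

text \<open>On a half-open interval of length 1 the fractional part drops only once, by 1, at the single integer
  that may lie inside; this rotates the order.\<close>

lemma frac_cyclic_order:
  fixes u v w :: real
  assumes "u < v" "v < w" "w < u + 1"
  shows "frac u < frac v \<and> frac v < frac w \<or> frac v < frac w \<and> frac w < frac u \<or>
    frac w < frac u \<and> frac u < frac v"
proof -
  define m where "m = \<lfloor>u\<rfloor>"
  have u: "of_int m \<le> u" "u < of_int m + 1" by (auto simp: m_def)
  have fl: "frac x = (if x < of_int m + 1 then x - of_int m else x - of_int m - 1)"
    if "of_int m \<le> x" "x < of_int m + 2" for x
  proof (cases "x < of_int m + 1")
    case True
    then have "\<lfloor>x\<rfloor> = m" using that by (simp add: floor_eq_iff)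
    then show ?thesis using True by (simp add: frac_def)
  next
    case False
    then have "\<lfloor>x\<rfloor> = m + 1" using that by (simp add: floor_eq_iff)
    then show ?thesis using False by (simp add: frac_def)
  qed
  show ?thesis using assms u fl[of u] fl[of v] fl[of w] by auto
qed

lemma cis_2pi_eq_iff: "cis (2 * pi * x) = cis (2 * pi * y) \<longleftrightarrow> frac x = frac y"
proof -
  have "cis (2 * pi * x) = cis (2 * pi * y) \<longleftrightarrow> (\<exists>n::int. x = y + of_int n)"
  proof -
    have "cis (2 * pi * x) = cis (2 * pi * y) \<longleftrightarrow>
        (\<exists>n::int. \<i> * of_real (2 * pi * x) = \<i> * of_real (2 * pi * y) + complex_of_real (of_int (2 * n) * pi) * \<i>)"
      by (simp add: cis_conv_exp exp_eq)
    also have "\<dots> \<longleftrightarrow> (\<exists>n::int. 2 * pi * x = 2 * pi * y + of_int (2 * n) * pi)"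
      by (intro ex_cong1) (auto simp: complex_eq_iff)
    also have "\<dots> \<longleftrightarrow> (\<exists>n::int. x = y + of_int n)"
    proof (intro ex_cong1)
      fix n :: int
      have "2 * pi * x = 2 * pi * y + of_int (2 * n) * pi \<longleftrightarrow> 2 * pi * x = 2 * pi * (y + of_int n)"
        by (simp add: algebra_simps)
      then show "2 * pi * x = 2 * pi * y + of_int (2 * n) * pi \<longleftrightarrow> x = y + of_int n" by simp
    qed
    finally show ?thesis .
  qed
  also have "\<dots> \<longleftrightarrow> frac x = frac y"
  proof
    assume "frac x = frac y"
    then have "x = y + of_int (\<lfloor>x\<rfloor> - \<lfloor>y\<rfloor>)" by (simp add: frac_def)
    then show "\<exists>n::int. x = y + of_int n" ..
  qed (auto simp: frac_def)
  finally show ?thesis .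
qed

text \<open>On \<open>[0, 1)\<close> the map \<open>f\<close> is the fractional part of the increasing lift \<open>L\<close>. The lift stays below
  \<open>L 0 + 1\<close> there: otherwise the intermediate value theorem gives a point in \<open>(0, 1)\<close> where \<open>L\<close> equals
  \<open>L 0 + 1\<close>, and the circle map would not be injective.\<close>

lemma thompson_T_cyclic_order:
  assumes f: "f \<in> thompson_T" and xyz: "0 \<le> x" "x < y" "y < z" "z < 1"
  shows "f x < f y \<and> f y < f z \<or> f y < f z \<and> f z < f x \<or> f z < f x \<and> f x < f y"
proof -
  obtain h where h: "orientation_preserving_circle_homeo h"
    and hf: "\<And>x. x \<in> {0..<1} \<Longrightarrow> h (cis (2 * pi * x)) = cis (2 * pi * f x)"
    using f unfolding thompson_T_def by blast
  have into: "\<And>x. x \<in> {0..<1} \<Longrightarrow> f x \<in> {0..<1}"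
    using f by (auto simp: thompson_T_def thompson_V_def Bij_def bij_betw_def)
  obtain h' L where hom: "homeomorphism (sphere 0 1) (sphere 0 1) h h'"
    and L: "continuous_on UNIV L" "strict_mono L"
    and hL: "\<And>x. h (cis (2 * pi * x)) = cis (2 * pi * L x)"
    using h unfolding orientation_preserving_circle_homeo_def by blast
  have fL: "f x = frac (L x)" if "x \<in> {0..<1}" for x
  proof -
    have "frac (f x) = f x" using into[OF that] by (simp add: frac_eq)
    moreover have "frac (f x) = frac (L x)" using hf[OF that] hL[of x] cis_2pi_eq_iff by metis
    ultimately show ?thesis by simp
  qed
  have "L z < L 0 + 1"
  proof (rule ccontr)
    assume "\<not> L z < L 0 + 1"
    then obtain w where w: "0 \<le> w" "w \<le> z" "L w = L 0 + 1"
      using IVT'[of L 0 "L 0 + 1" z] xyz continuous_on_subset[OF L(1)] by force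
    have "frac (L w) = frac (L 0)" unfolding w by (simp add: frac_def)
    then have "h (cis (2 * pi * w)) = h (cis (2 * pi * 0))" unfolding hL cis_2pi_eq_iff .
    then have "h' (h (cis (2 * pi * w))) = h' (h (cis (2 * pi * 0)))" by simp
    then have "cis (2 * pi * w) = cis (2 * pi * 0)"
      using hom by (simp add: homeomorphism_def)
    then have "frac w = frac 0" unfolding cis_2pi_eq_iff .
    moreover have "frac w = w" using w xyz by (simp add: frac_eq)
    ultimately show False using w by simp
  qed
  moreover have "L 0 \<le> L x" "L x < L y" "L y < L z"
    using L(2) xyz by (auto simp: strict_mono_less strict_mono_less_eq)
  ultimately show ?thesis
    using frac_cyclic_order[of "L x" "L y" "L z"] xyz by (simp add: fL)
qed

lemma thompson_F_less:
  assumes "f \<in> thompson_F" "0 \<le> x" "x < y" "y < 1"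
  shows "f x < f y"
  using assms unfolding thompson_F_def by (auto simp: strict_mono_on_def)

lemma thompson_carrier_subset_V: "thompson_carrier K \<subseteq> thompson_V"
  by (cases K) (auto simp: thompson_F_def thompson_T_def)

lemma BijGroup_pow:
  assumes "f \<in> Bij S"
  shows "f [^]\<^bsub>BijGroup S\<^esub> (n::nat) \<in> Bij S \<and> (\<forall>x\<in>S. (f [^]\<^bsub>BijGroup S\<^esub> n) x = (f ^^ n) x)"
proof (induction n)
  case 0
  then show ?case using id_Bij[of S] by (simp add: BijGroup_def restrict_def)
next
  case (Suc n)
  have "f x \<in> S" if "x \<in> S" for x using assms that by (auto simp: Bij_def bij_betw_def)
  then show ?case using Suc assms
    by (auto simp: BijGroup_def compose_Bij compose_eq funpow_Suc_right simp del: funpow.simps)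
qed

lemma torsion_element_funpow:
  assumes "torsion_element (thompson_group K) f"
  shows "\<exists>n>0. \<forall>x\<in>{0..<1}. (f ^^ n) x = x"
proof -
  obtain n :: nat where n: "n > 0" and fK: "f \<in> thompson_carrier K"
    and "f [^]\<^bsub>thompson_group K\<^esub> n = \<one>\<^bsub>thompson_group K\<^esub>"
    using assms by (auto simp: torsion_element_def thompson_group_def)
  then have "f [^]\<^bsub>BijGroup {0..<1}\<^esub> n = (\<lambda>x\<in>{0..<1}. x)"
    by (simp add: thompson_group_def nat_pow_def BijGroup_def)
  moreover have "f \<in> Bij {0..<1}"
    using fK thompson_carrier_subset_V by (auto simp: thompson_V_def)
  ultimately show ?thesis using BijGroup_pow[of f "{0..<1}" n] n by auto
qed

section \<open>The marked tree pair diagram\<close>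

text \<open>Here \<open>l i\<close> stands for the left endpoint of leaf \<open>i\<close>. As \<open>l\<close> is increasing, comparing \<open>\<sigma> i\<close> with \<open>\<sigma> j\<close> amounts
  to comparing the values of \<open>f\<close> at \<open>l i\<close> and \<open>l j\<close>.\<close>

lemma admissible_marking_if_left_endpoints:
  assumes f: "f \<in> thompson_carrier K"
    and l: "strict_mono_on {..<n} l" "l ` {..<n} \<subseteq> {0..<1}"
    and \<sigma>: "\<sigma> ` {..<n} \<subseteq> {..<n}" "\<And>i. i < n \<Longrightarrow> f (l i) = l (\<sigma> i)"
  shows "admissible_marking K n \<sigma>"
proof -
  have less: "\<sigma> i < \<sigma> j \<longleftrightarrow> f (l i) < f (l j)" if "i < n" "j < n" for i j
    using \<sigma> that l(1) by (auto simp: strict_mono_on_less image_subset_iff)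
  have lt: "l i < l j" if "i < j" "j < n" for i j
    using l(1) that by (auto simp: strict_mono_on_def)
  have l01: "0 \<le> l i" "l i < 1" if "i < n" for i using l(2) that by auto
  show ?thesis
  proof (cases K)
    case Kind_F
    have "\<sigma> i < \<sigma> j" if "i < j" "j < n" for i j
      using that less[of i j] f Kind_F thompson_F_less[of f "l i" "l j"] lt[of i j] l01[of i] l01[of j]
      by simp
    then show ?thesis by (auto simp: Kind_F strict_mono_on_def)
  next
    case Kind_T
    have *: "cyclically_ordered (\<sigma> i) (\<sigma> j) (\<sigma> k)" if "i < j" "j < k" "k < n" for i j k
      using thompson_T_cyclic_order[of f "l i" "l j" "l k"] that f Kind_T lt[of i j] lt[of j k] l01[of i] l01[of k]
        less[of i j] less[of j k] less[of k i]
      by (simp add: cyclically_ordered_def)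
    \<comment> \<open>Rotating a cyclically ordered triple makes it increasing, the case just treated.\<close>
    have rot: "cyclically_ordered a b c \<Longrightarrow> cyclically_ordered b c a" for a b c
      by (auto simp: cyclically_ordered_def)
    show ?thesis unfolding Kind_T admissible_marking.simps
    proof (intro allI impI)
      fix i j k assume ijk: "i < n" "j < n" "k < n" "cyclically_ordered i j k"
      then consider "i < j" "j < k" | "j < k" "k < i" | "k < i" "i < j"
        unfolding cyclically_ordered_def by blast
      then show "cyclically_ordered (\<sigma> i) (\<sigma> j) (\<sigma> k)"
      proof cases
        case 1
        then show ?thesis using * ijk by simp
      next
        case 2
        then show ?thesis using *[of j k i] rot ijk by simp
      next
        case 3
        then show ?thesis using *[of k i j] rot ijk by simp
      qed
    qed
  next
    case Kind_V
    then show ?thesis by simp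
  qed
qed

theorem proposition6p1:
  fixes K :: thompson_kind and f :: "real \<Rightarrow> real"
  assumes "torsion_element (thompson_group K) f"
  shows "\<exists>t \<sigma>. tree_pair_diagram K t t \<sigma> \<and> represents t t \<sigma> f"
proof -
  have fK: "f \<in> thompson_carrier K"
    using assms by (auto simp: torsion_element_def thompson_group_def)
  then have fV: "f \<in> thompson_V" using thompson_carrier_subset_V by blast
  obtain n where n: "n > 0" "\<And>x. x \<in> {0..<1} \<Longrightarrow> (f ^^ n) x = x"
    using torsion_element_funpow[OF assms] by blast
  obtain t where t: "\<forall>(a, b)\<in>set (subdivision t). \<exists>(c, d)\<in>set (subdivision t). affine_onto f a b c d"
    using exists_invariant_tree[OF fV n] by blast
  define m where "m = num_leaves t"
  define lo hi where "lo i = fst (subdivision t ! i)" and "hi i = snd (subdivision t ! i)" for i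
  have sub: "subdivision t ! i = (lo i, hi i)" for i by (simp add: lo_def hi_def)
  have mem: "(lo i, hi i) \<in> set (subdivision t)" if "i < m" for i
    using that by (auto simp: m_def num_leaves_def simp flip: sub)
  have bds: "0 \<le> lo i" "lo i < hi i" "hi i \<le> 1" if i: "i < m" for i
  proof -
    obtain r where r: "dyadic_interval r (lo i) (hi i)"
      using leaf_intervals_descendant mem[OF i] unfolding subdivision_def by blast
    show "0 \<le> lo i" "lo i < hi i" "hi i \<le> 1" using descendant_bounds[OF r] by simp_all
  qed
  have lo_less: "lo i < lo j" if "i < j" "j < m" for i j
  proof -
    have "hi i \<le> lo j"
      using sorted_wrt_nth_less[OF leaf_intervals_sorted[of 0 1 t], of i j] that
      by (simp add: lo_def hi_def m_def num_leaves_def subdivision_def)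
    then show ?thesis using bds(2)[of i] that by simp
  qed
  have "\<exists>j<m. affine_onto f (lo i) (hi i) (lo j) (hi j)" if i: "i < m" for i
  proof -
    obtain c d where cd: "(c, d) \<in> set (subdivision t)" "affine_onto f (lo i) (hi i) c d"
      using t mem[OF i] by blast
    then obtain j where "j < m" "(c, d) = (lo j, hi j)"
      by (metis in_set_conv_nth m_def num_leaves_def sub)
    then show ?thesis using cd by auto
  qed
  then obtain \<sigma> where \<sigma>: "\<And>i. i < m \<Longrightarrow> \<sigma> i < m"
    and aff: "\<And>i. i < m \<Longrightarrow> affine_onto f (lo i) (hi i) (lo (\<sigma> i)) (hi (\<sigma> i))"
    by metis
  have f_lo: "f (lo i) = lo (\<sigma> i)" if "i < m" for i
    using affine_onto_start[OF aff] bds that by blast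
  have lo_mono: "strict_mono_on {..<m} lo" using lo_less by (auto simp: strict_mono_on_def)
  have lo01: "lo ` {..<m} \<subseteq> {0..<1}" using bds by force
  have "inj_on f {0..<1}" using fV by (auto simp: thompson_V_def Bij_def bij_betw_def)
  then have "inj_on (f \<circ> lo) {..<m}"
    using lo01 strict_mono_on_imp_inj_on[OF lo_mono] by (meson comp_inj_on inj_on_subset)
  then have "inj_on (lo \<circ> \<sigma>) {..<m}" using f_lo by (simp add: inj_on_def)
  then have "inj_on \<sigma> {..<m}" by (rule inj_on_imageI2)
  then have "bij_betw \<sigma> {..<m} {..<m}"
    using \<sigma> endo_inj_surj[of "{..<m}" \<sigma>] by (auto simp: bij_betw_def)
  moreover have "admissible_marking K m \<sigma>"
    using \<sigma> f_lo by (intro admissible_marking_if_left_endpoints[OF fK lo_mono lo01]) auto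
  moreover have "represents t t \<sigma> f"
    using aff unfolding represents_def sub affine_onto_def by (auto simp: m_def)
  ultimately show ?thesis
    unfolding tree_pair_diagram_def marked_tree_pair_def m_def by blast
qed

end
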